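(* Given the pairwise frequencies $f_X$ of a search sequence $X = x_1,\ldots,x_m$ over $\{1,\ldots,n\}$ and a constant $d$ with $1 \le d \le n$, the multiple trees structure executes $X$ in time $O(m\, H_c(f_X) \log_d n)$ and uses space $O(nd)$.
   Context: $f_X(a)$ is the number of searches to $a$ in $X$, and $f_X(a,b)$ is the number of indices $i$ with $x_{i-1}=a$ and $x_i = b$. The conditional entropy is $H_c(f_X) = \sum_{a=1}^n\sum_{b=1}^n \frac{f_X(a,b)}{m}\lg\frac{f_X(a)}{f_X(a,b)}$ (terms with $f_X(a,b)=0$ omitted), with $\lg$ the base-2 logarithm. The multiple trees structure (a comparison-based pointer-machine structure) consists of: (1) a complete (balanced) binary search tree $T'$ on all keys $\{1,\ldots,n\}$, of height $O(\lg n)$; (2) for each $i \in \{1,\ldots,n\}$, a binary search tree $T_i$ containing the $d$ keys $j$ with the greatest frequencies $f_X(i,j)$, arranged so that the depth of $j$ in $T_i$ is $O(\lg \frac{f_X(i)}{f_X(i,j)})$; (3) for every key $j$ (in every tree where it occurs), a pointer from $j$ to the root of $T_j$. A search for $j$, when the previous search was for $i$ and the finger is at the root of $T_i$, proceeds by searching for $j$ in $T_i$; if $j$ is not in $T_i$, $j$ is searched in $T'$; once $j$ is found, the finger moves to the root of $T_j$ via the pointer.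
   Formalization: The time bound carries an additive overhead 2m + lg n (unit cost of each search and the initial search in T'), since the bound fails for X = 1,1,...,1 where m H_c stays bounded; the logarithm's base is max(2,d), as log_1 n is undefined. *)

theory Defs
  imports Complex_Main "HOL-Library.Tree"
begin

definition freq :: "nat list \<Rightarrow> nat \<Rightarrow> nat" where
  "freq X a = count_list X a"

definition pair_freq :: "nat list \<Rightarrow> nat \<Rightarrow> nat \<Rightarrow> nat" where
  "pair_freq X a b = card {k. Suc k < length X \<and> X ! k = a \<and> X ! Suc k = b}"

definition cond_entropy :: "nat \<Rightarrow> nat list \<Rightarrow> real" where
  "cond_entropy n X =
     (\<Sum>a = 1..n. \<Sum>b = 1..n.
        if pair_freq X a b = 0 then 0
        else real (pair_freq X a b) / real (length X)
               * log 2 (real (freq X a) / real (pair_freq X a b)))"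

text \<open>Number of edges from the root down to the node of a key; only meaningful for keys
  occurring in the search tree.\<close>

fun depth :: "nat tree \<Rightarrow> nat \<Rightarrow> nat" where
  "depth \<langle>\<rangle> j = 0"
| "depth \<langle>l, a, r\<rangle> j = (if j = a then 0 else Suc (depth (if j < a then l else r) j))"

text \<open>Outcome of a root-to-leaf search, and the number of nodes it visits (one comparison
  with the key of each visited node).\<close>

fun found :: "nat tree \<Rightarrow> nat \<Rightarrow> bool" where
  "found \<langle>\<rangle> j = False"
| "found \<langle>l, a, r\<rangle> j = (j = a \<or> found (if j < a then l else r) j)"

fun visits :: "nat tree \<Rightarrow> nat \<Rightarrow> nat" where
  "visits \<langle>\<rangle> j = 0"
| "visits \<langle>l, a, r\<rangle> j = Suc (if j = a then 0 else visits (if j < a then l else r) j)"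

text \<open>\<open>Whole\<close> names the tree $T'$ and \<open>After i\<close> the tree $T_i$. As a pointer value, such a name
  stands for the root of the tree; \<open>link S t j\<close> is the pointer stored at key \<open>j\<close> of tree \<open>t\<close>.\<close>

datatype tree_id = Whole | After nat

record forest =
  tree_of :: "tree_id \<Rightarrow> nat tree"
  link :: "tree_id \<Rightarrow> nat \<Rightarrow> tree_id"

text \<open>\<open>K\<close> consists of \<open>d\<close> keys of greatest value under \<open>w\<close>, ties broken arbitrarily.\<close>

definition top_keys :: "nat \<Rightarrow> nat \<Rightarrow> (nat \<Rightarrow> nat) \<Rightarrow> nat set \<Rightarrow> bool" where
  "top_keys n d w K \<longleftrightarrow>
     K \<subseteq> {1..n} \<and> card K = d \<and> (\<forall>a\<in>K. \<forall>b\<in>{1..n} - K. w b \<le> w a)"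

text \<open>The parameter \<open>c\<close> is the constant hidden in the depth requirement
  $O(\lg (f(i) / f(i,j)))$, which is void for $f(i,j) = 0$. A logarithmic height of $T'$ follows
  from \<open>acomplete\<close>.\<close>

definition multiple_trees ::
  "real \<Rightarrow> nat \<Rightarrow> nat \<Rightarrow> (nat \<Rightarrow> nat) \<Rightarrow> (nat \<Rightarrow> nat \<Rightarrow> nat) \<Rightarrow> forest \<Rightarrow> bool" where
  "multiple_trees c n d f f2 S \<longleftrightarrow>
     bst (tree_of S Whole) \<and> set_tree (tree_of S Whole) = {1..n} \<and> acomplete (tree_of S Whole) \<and>
     (\<forall>i\<in>{1..n}.
        bst (tree_of S (After i)) \<and>
        top_keys n d (f2 i) (set_tree (tree_of S (After i))) \<and>
        (\<forall>j\<in>set_tree (tree_of S (After i)). f2 i j > 0 \<longrightarrow>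
           real (depth (tree_of S (After i)) j) \<le> c * log 2 (real (f i) / real (f2 i j)))) \<and>
     (\<forall>t\<in>insert Whole (After ` {1..n}). \<forall>j\<in>set_tree (tree_of S t). link S t j = After j)"

text \<open>One search with the finger at the root of tree \<open>t\<close>: the new finger position and the time,
  where every visited node and every pointer to a root that is followed (to $T'$ after a failed
  search, and from the found key) costs one unit.\<close>

definition search_step :: "forest \<Rightarrow> tree_id \<Rightarrow> nat \<Rightarrow> tree_id \<times> nat" where
  "search_step S t j =
     (if found (tree_of S t) j
      then (link S t j, visits (tree_of S t) j + 1)
      else (link S Whole j, visits (tree_of S t) j + 1 + visits (tree_of S Whole) j + 1))"

fun run_time :: "forest \<Rightarrow> tree_id \<Rightarrow> nat list \<Rightarrow> nat" where
  "run_time S t [] = 0"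
| "run_time S t (x # xs) = snd (search_step S t x) + run_time S (fst (search_step S t x)) xs"

text \<open>There is no previous search before the first one, which therefore starts at the root
  of $T'$.\<close>

definition exec_time :: "forest \<Rightarrow> nat list \<Rightarrow> nat" where
  "exec_time S X = run_time S Whole X"

text \<open>Memory words: four per node (key, two children, link), the pointer to the root of $T'$,
  and the finger.\<close>

definition space :: "nat \<Rightarrow> forest \<Rightarrow> nat" where
  "space n S = 4 * (size (tree_of S Whole) + (\<Sum>i = 1..n. size (tree_of S (After i)))) + 2"

end

theory Submission imports Defs "HOL-Library.Tree_Real" begin

text \<open>A tree that splits at weighted medians halves the weight on every step down, so a key of
  weight \<open>w\<close> in a tree of total weight \<open>W\<close> has depth at most \<open>lg (W / w)\<close>. This yields the
  trees \<open>T\<^sub>i\<close> with constant 1, and with unit weights also the balanced tree \<open>T'\<close>.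

  For the running time, a search for \<open>b\<close> after \<open>a\<close> costs two units plus a depth bounded by
  \<open>c L\<close>, \<open>L = lg (f(a) / f(a,b))\<close>, if \<open>b\<close> is in \<open>T\<^sub>a\<close>. Otherwise all \<open>d\<close> keys of \<open>T\<^sub>a\<close> are at
  least as frequent as \<open>b\<close>, so \<open>f(a) \<ge> (d + 1) f(a,b)\<close> and \<open>L \<ge> lg (d + 1)\<close>; hence
  the \<open>lg n\<close> steps in \<open>T'\<close> are at most \<open>L log\<^sub>d n\<close>. Summing \<open>L\<close> over the consecutive pairs
  gives \<open>m H\<^sub>c\<close>.\<close>

subsection \<open>Trees split at weighted medians\<close>

fun median_split :: "('a \<Rightarrow> nat) \<Rightarrow> 'a tree \<Rightarrow> bool" where
  "median_split w \<langle>\<rangle> \<longleftrightarrow> True"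
| "median_split w \<langle>l, a, r\<rangle> \<longleftrightarrow>
     2 * sum w (set_tree l) \<le> sum w (set_tree \<langle>l, a, r\<rangle>) \<and>
     2 * sum w (set_tree r) \<le> sum w (set_tree \<langle>l, a, r\<rangle>) \<and>
     median_split w l \<and> median_split w r"

text \<open>Take \<open>m\<close> as the least key whose initial segment carries at least half of
  the weight. The keys below \<open>m\<close> form the initial segment of its predecessor
  \<open>p\<close>, which falls short of half by minimality; the keys above \<open>m\<close> are the
  complement of a segment with at least half.\<close>

lemma weighted_median:
  fixes w :: "'a::linorder \<Rightarrow> nat"
  assumes "finite K" "K \<noteq> {}"
  obtains m where "m \<in> K" "2 * sum w {x\<in>K. x < m} \<le> sum w K" "2 * sum w {x\<in>K. m < x} \<le> sum w K"
proof -
  let ?M = "{m\<in>K. sum w K \<le> 2 * sum w {x\<in>K. x \<le> m}}"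
  have "{x\<in>K. x \<le> Max K} = K" using assms by auto
  then have "Max K \<in> ?M" using assms by simp
  then have "finite ?M" "?M \<noteq> {}" using assms by (simp, blast)
  define m where "m = Min ?M"
  have m: "m \<in> ?M" unfolding m_def by (rule Min_in) fact+
  have min: "m \<le> p" if "p \<in> ?M" for p
    unfolding m_def using \<open>finite ?M\<close> that by (rule Min_le)
  have lo: "2 * sum w {x\<in>K. x < m} \<le> sum w K"
  proof (cases "{x\<in>K. x < m} = {}")
    case True
    then show ?thesis by (simp only: sum.empty)
  next
    case False
    define p where "p = Max {x\<in>K. x < m}"
    have p: "p \<in> {x\<in>K. x < m}" unfolding p_def using False assms by (intro Max_in) auto
    have "x \<le> p" if "x \<in> K" "x < m" for x
      unfolding p_def using that assms by (intro Max_ge) auto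
    then have "{x\<in>K. x < m} = {x\<in>K. x \<le> p}" using p by fastforce
    moreover have "p \<notin> ?M" using min[of p] p by fastforce
    ultimately show ?thesis using p by simp
  qed
  have "K = {x\<in>K. x \<le> m} \<union> {x\<in>K. m < x}" by auto
  then have "sum w K = sum w ({x\<in>K. x \<le> m} \<union> {x\<in>K. m < x})" by simp
  also have "\<dots> = sum w {x\<in>K. x \<le> m} + sum w {x\<in>K. m < x}"
    using assms by (intro sum.union_disjoint) auto
  finally have "2 * sum w {x\<in>K. m < x} \<le> sum w K" using m by simp
  then show ?thesis using that[of m] m lo by blast
qed

lemma median_split_tree_exists:
  fixes w :: "'a::linorder \<Rightarrow> nat"
  assumes "finite K"
  shows "\<exists>t. bst t \<and> set_tree t = K \<and> median_split w t"
  using assms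
proof (induction K rule: finite_psubset_induct)
  case (psubset K)
  show ?case
  proof (cases "K = {}")
    case True
    then show ?thesis by (intro exI[of _ Leaf]) simp
  next
    case False
    obtain m where m: "m \<in> K" "2 * sum w {x\<in>K. x < m} \<le> sum w K"
      "2 * sum w {x\<in>K. m < x} \<le> sum w K"
      using weighted_median[OF psubset.hyps False] by blast
    obtain l where l: "bst l" "set_tree l = {x\<in>K. x < m}" "median_split w l"
      using psubset.IH[of "{x\<in>K. x < m}"] m(1) by blast
    obtain r where r: "bst r" "set_tree r = {x\<in>K. m < x}" "median_split w r"
      using psubset.IH[of "{x\<in>K. m < x}"] m(1) by blast
    have "set_tree \<langle>l, m, r\<rangle> = K" using m(1) by (auto simp: l(2) r(2))
    then have "median_split w \<langle>l, m, r\<rangle>"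
      using l r m(2,3) by (simp only: median_split.simps)
    moreover have "bst \<langle>l, m, r\<rangle>" using l r by auto
    ultimately show ?thesis using \<open>set_tree \<langle>l, m, r\<rangle> = K\<close> by blast
  qed
qed

text \<open>Each step down at most halves the weight, which pays for one more factor 2. The product
  form also covers keys of weight 0, where a logarithm of the ratio would be meaningless.\<close>

lemma median_split_depth:
  assumes "bst t" "median_split w t" "j \<in> set_tree t"
  shows "2 ^ depth t j * w j \<le> sum w (set_tree t)"
  using assms
proof (induction t)
  case Leaf
  then show ?case by simp
next
  case (Node l a r)
  consider "j = a" | "j < a" "j \<in> set_tree l" | "a < j" "j \<in> set_tree r"
    using Node.prems by auto
  then show ?case
  proof cases
    case 1
    then show ?thesis using member_le_sum[of j "set_tree \<langle>l, a, r\<rangle>" w] by simp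
  next
    case 2
    then have "2 ^ depth l j * w j \<le> sum w (set_tree l)" using Node by simp
    with 2 Node.prems(2) show ?thesis by simp
  next
    case 3
    then have "2 ^ depth r j * w j \<le> sum w (set_tree r)" using Node by simp
    with 3 Node.prems(2) show ?thesis by simp
  qed
qed

lemma bst_size_eq_card: "bst t \<Longrightarrow> size t = card (set_tree t)"
  for t :: "'a::linorder tree"
proof (induction t)
  case (Node l a r)
  then have "a \<notin> set_tree l \<union> set_tree r" "set_tree l \<inter> set_tree r = {}" by fastforce+
  with Node show ?case by (simp add: card_Un_disjoint)
qed simp

text \<open>Unit weights turn subtree weights into sizes, and
  \<open>2 * size l <= size l + size r + 1\<close> with its mirror image says that the sizes differ
  by at most 1.\<close>

lemma wbalanced_if_median_split:
  fixes t :: "'a::linorder tree"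
  shows "bst t \<Longrightarrow> median_split (\<lambda>_. 1) t \<Longrightarrow> wbalanced t"
proof (induction t)
  case (Node l a r)
  have "card (set_tree \<langle>l, a, r\<rangle>) = size l + size r + 1"
    using bst_size_eq_card[OF Node.prems(1)] by simp
  then have "2 * size l \<le> size l + size r + 1" "2 * size r \<le> size l + size r + 1"
    using Node.prems by (auto simp: bst_size_eq_card)
  with Node show ?case by auto
qed simp

lemma acomplete_bst_exists:
  fixes K :: "'a::linorder set"
  assumes "finite K"
  shows "\<exists>t. bst t \<and> set_tree t = K \<and> acomplete t"
  using median_split_tree_exists[OF assms] wbalanced_if_median_split acomplete_if_wbalanced
  by blast

subsection \<open>Searching in a tree\<close>

lemma found_iff: "bst t \<Longrightarrow> found t j \<longleftrightarrow> j \<in> set_tree t"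
  by (induction t) auto

lemma visits_eq_depth: "found t j \<Longrightarrow> visits t j = Suc (depth t j)"
  by (induction t) (auto split: if_splits)

lemma visits_le_height: "visits t j \<le> height t"
  by (induction t) auto

lemma depth_less_size: "found t j \<Longrightarrow> depth t j < size t"
  by (induction t) (auto split: if_splits)

text \<open>Meant for failed searches, whose key has no meaningful depth: the search path ends at a
  key \<open>k\<close> of the tree that does.\<close>

lemma visits_le_depth:
  "bst t \<Longrightarrow> t \<noteq> \<langle>\<rangle> \<Longrightarrow> \<exists>k\<in>set_tree t. visits t j \<le> Suc (depth t k)"
proof (induction t)
  case (Node l a r)
  consider "j = a \<or> j < a \<and> l = \<langle>\<rangle> \<or> j > a \<and> r = \<langle>\<rangle>" | "j < a" "l \<noteq> \<langle>\<rangle>" | "j > a" "r \<noteq> \<langle>\<rangle>"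
    by fastforce
  then show ?case
  proof cases
    case 1
    then show ?thesis by auto
  next
    case 2
    then obtain k where "k \<in> set_tree l" "visits l j \<le> Suc (depth l k)" using Node by auto
    moreover from this have "k < a" using Node.prems by simp
    ultimately show ?thesis using 2 by (intro bexI[of _ k]) auto
  next
    case 3
    then obtain k where "k \<in> set_tree r" "visits r j \<le> Suc (depth r k)" using Node by auto
    moreover from this have "a < k" using Node.prems by simp
    ultimately show ?thesis using 3 by (intro bexI[of _ k]) auto
  qed
qed simp

text \<open>The height is the ceiling of lg (size + 1). Integrality improves this:
  \<open>2 ^ h < size + 1\<close> forces \<open>2 ^ h <= size\<close>.\<close>

lemma acomplete_height_le:
  assumes "acomplete t" "t \<noteq> \<langle>\<rangle>"
  shows "real (height t) \<le> 1 + log 2 (size t)"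
proof -
  obtain h where h: "height t = Suc h" using assms(2) by (cases t) auto
  have "int (height t) = \<lceil>log 2 (size1 t)\<rceil>"
    using height_acomplete[OF assms(1)] h by linarith
  then have "real h < log 2 (size1 t)" using h by linarith
  then have "2 powr real h < real (size1 t)"
    by (subst (asm) less_log_iff) (auto simp: size1_size)
  then have "real (2 ^ h) < real (size1 t)" by (simp add: powr_realpow)
  then have "2 ^ h \<le> size t" by (simp only: of_nat_less_iff size1_size)
  then have "real (2 ^ h) \<le> real (size t)" by (simp only: of_nat_le_iff)
  then have "real h \<le> log 2 (size t)"
    using assms(2) by (subst le_log_iff) (auto simp: powr_realpow neq_Leaf_iff)
  then show ?thesis using h by simp
qed

subsection \<open>Pair frequencies\<close>

text \<open>Different \<open>b\<close> count disjoint sets of occurrences of \<open>a\<close>.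
  Equality can fail, since the last position of \<open>X\<close> has no successor.\<close>

lemma sum_pair_freq_le_freq:
  assumes "finite B"
  shows "(\<Sum>b\<in>B. pair_freq X a b) \<le> freq X a"
proof -
  let ?P = "\<lambda>b. {k. Suc k < length X \<and> X ! k = a \<and> X ! Suc k = b}"
  have "finite (?P b)" for b by (rule finite_subset[of _ "{..<length X}"]) auto
  then have "(\<Sum>b\<in>B. card (?P b)) = card (\<Union>b\<in>B. ?P b)"
    using assms by (intro card_UN_disjoint[symmetric]) auto
  also have "\<dots> \<le> card {k. k < length X \<and> X ! k = a}" by (intro card_mono) auto
  also have "\<dots> = freq X a"
    by (simp add: freq_def count_list_eq_length_filter length_filter_conv_card eq_commute)
  finally show ?thesis by (simp add: pair_freq_def)
qed

text \<open>Double counting: positions are grouped by the pair read there, and the group of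
  \<open>(a, b)\<close> has \<open>pair_freq X a b\<close> members.\<close>

lemma sum_consecutive_pairs:
  fixes g :: "nat \<Rightarrow> nat \<Rightarrow> real"
  assumes "set X \<subseteq> A" "finite A"
  shows "(\<Sum>k<length X - 1. g (X ! k) (X ! Suc k)) = (\<Sum>a\<in>A. \<Sum>b\<in>A. pair_freq X a b * g a b)"
proof -
  let ?I = "{..<length X - 1}"
  have "(\<Sum>a\<in>A. \<Sum>b\<in>A. pair_freq X a b * g a b)
    = (\<Sum>p\<in>A\<times>A. \<Sum>k\<in>{k\<in>?I. (X ! k, X ! Suc k) = p}. g (X ! k) (X ! Suc k))"
    unfolding sum.cartesian_product
  proof (intro sum.cong refl, clarify)
    fix a b
    have "(\<Sum>k\<in>{k\<in>?I. (X ! k, X ! Suc k) = (a, b)}. g (X ! k) (X ! Suc k))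
      = (\<Sum>k\<in>{k\<in>?I. (X ! k, X ! Suc k) = (a, b)}. g a b)"
      by (intro sum.cong) auto
    also have "\<dots> = pair_freq X a b * g a b"
    proof -
      have "{k\<in>?I. (X ! k, X ! Suc k) = (a, b)}
        = {k. Suc k < length X \<and> X ! k = a \<and> X ! Suc k = b}" by auto
      then show ?thesis unfolding pair_freq_def by (simp only: sum_constant)
    qed
    finally show "pair_freq X a b * g a b
      = (\<Sum>k\<in>{k\<in>?I. (X ! k, X ! Suc k) = (a, b)}. g (X ! k) (X ! Suc k))"
      by (rule sym)
  qed
  also have "\<dots> = (\<Sum>k\<in>?I. g (X ! k) (X ! Suc k))"
    using assms by (intro sum.group) (auto simp: subset_iff)
  finally show ?thesis by simp
qed

text \<open>The length cancels the normalisation, and the omitted pairs have factor 0 in the grouped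
  sum too. Entropy thus becomes one term for each search after the first.\<close>

lemma length_times_cond_entropy:
  assumes "set X \<subseteq> {1..n}" "X \<noteq> []"
  shows "length X * cond_entropy n X =
    (\<Sum>k<length X - 1. log 2 (freq X (X ! k) / pair_freq X (X ! k) (X ! Suc k)))"
  unfolding cond_entropy_def
  using assms(2) sum_consecutive_pairs[OF assms(1), of "\<lambda>a b. log 2 (freq X a / pair_freq X a b)"]
  by (auto simp: sum_distrib_left intro!: sum.cong)

subsection \<open>Existence of the structure\<close>

text \<open>Greedy choice: a heaviest key outside \<open>K\<close> joins \<open>K\<close>, and the
  older keys still dominate everything left.\<close>

lemma top_keys_exists:
  assumes "d \<le> n"
  shows "\<exists>K. top_keys n d w K"
  using assms
proof (induction d)
  case 0
  then show ?case by (intro exI[of _ "{}"]) (simp add: top_keys_def)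
next
  case (Suc d)
  then obtain K where K: "K \<subseteq> {1..n}" "card K = d" "\<forall>a\<in>K. \<forall>b\<in>{1..n} - K. w b \<le> w a"
    unfolding top_keys_def by auto
  let ?R = "{1..n} - K"
  have "?R \<noteq> {}" using K Suc.prems card_mono[of K "{1..n}"] finite_subset[OF K(1)] by auto
  then obtain m where m: "m \<in> ?R" "\<And>b. b \<in> ?R \<Longrightarrow> w b \<le> w m"
    using Max_in[of "w ` ?R"] Max_ge[of "w ` ?R"] by (smt (verit) finite_Diff finite_atLeastAtMost
        finite_imageI image_iff image_is_empty)
  have "top_keys n (Suc d) w (insert m K)"
    using K m finite_subset[OF K(1)] by (auto simp: top_keys_def)
  then show ?case by blast
qed

lemma multiple_trees_exists:
  assumes "d \<le> n" and le: "\<And>i B. finite B \<Longrightarrow> sum (f2 i) B \<le> f i"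
  shows "\<exists>S. multiple_trees 1 n d f f2 S"
proof -
  obtain T where T: "bst T" "set_tree T = {1..n}" "acomplete T"
    using acomplete_bst_exists[of "{1..n}"] by auto
  have "\<exists>t. bst t \<and> top_keys n d (f2 i) (set_tree t) \<and>
    (\<forall>j\<in>set_tree t. f2 i j > 0 \<longrightarrow> real (depth t j) \<le> 1 * log 2 (real (f i) / real (f2 i j)))" for i
  proof -
    obtain K where K: "top_keys n d (f2 i) K" using top_keys_exists[OF assms(1)] by blast
    then have "finite K" unfolding top_keys_def by (auto intro: finite_subset)
    then obtain t where t: "bst t" "set_tree t = K" "median_split (f2 i) t"
      using median_split_tree_exists by blast
    have "real (depth t j) \<le> log 2 (real (f i) / real (f2 i j))" if "j \<in> K" "f2 i j > 0" for j
    proof -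
      have "2 ^ depth t j * f2 i j \<le> f i"
        using median_split_depth[OF t(1,3), of j] le[OF \<open>finite K\<close>, of i] that t(2) by simp
      then have "real (2 ^ depth t j * f2 i j) \<le> real (f i)" by (simp only: of_nat_le_iff)
      then have "2 ^ depth t j \<le> real (f i) / real (f2 i j)" using that(2) by (simp add: field_simps)
      then have "log 2 (2 ^ depth t j) \<le> log 2 (real (f i) / real (f2 i j))"
        by (intro log_mono) auto
      then show ?thesis by (simp add: log_nat_power)
    qed
    then show ?thesis using t K by auto
  qed
  then obtain Ti where "\<And>i. bst (Ti i) \<and> top_keys n d (f2 i) (set_tree (Ti i)) \<and>
    (\<forall>j\<in>set_tree (Ti i). f2 i j > 0 \<longrightarrow>
      real (depth (Ti i) j) \<le> 1 * log 2 (real (f i) / real (f2 i j)))" by metis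
  then have "multiple_trees 1 n d f f2
    \<lparr>tree_of = (\<lambda>t. case t of Whole \<Rightarrow> T | After i \<Rightarrow> Ti i), link = (\<lambda>_. After)\<rparr>"
    using T by (simp add: multiple_trees_def)
  then show ?thesis by blast
qed

subsection \<open>Time and space\<close>

context
  fixes c :: real and n d :: nat and f :: "nat \<Rightarrow> nat" and f2 :: "nat \<Rightarrow> nat \<Rightarrow> nat" and S :: forest
  assumes mt: "multiple_trees c n d f f2 S"
begin

lemma whole_tree:
  "bst (tree_of S Whole)" "set_tree (tree_of S Whole) = {1..n}" "acomplete (tree_of S Whole)"
  using mt by (auto simp: multiple_trees_def)

lemma after_tree:
  assumes "i \<in> {1..n}"
  shows "bst (tree_of S (After i))" "top_keys n d (f2 i) (set_tree (tree_of S (After i)))"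
    "\<And>j. j \<in> set_tree (tree_of S (After i)) \<Longrightarrow> f2 i j > 0 \<Longrightarrow>
      real (depth (tree_of S (After i)) j) \<le> c * log 2 (real (f i) / real (f2 i j))"
  using mt assms by (auto simp: multiple_trees_def)

lemma size_after_tree: "i \<in> {1..n} \<Longrightarrow> size (tree_of S (After i)) = d"
  using after_tree[of i] by (simp add: bst_size_eq_card top_keys_def)

lemma size_whole_tree: "size (tree_of S Whole) = n"
  using whole_tree by (simp add: bst_size_eq_card)

lemma space_eq: "space n S = 4 * (n + n * d) + 2"
  by (simp add: space_def size_whole_tree size_after_tree)

text \<open>Since \<open>Whole\<close> holds every key, even a miss ends at a key with a link. The
  finger depends only on the key just searched, so the run time splits into terms for consecutive
  pairs.\<close>

lemma finger_after_search:
  assumes "t \<in> insert Whole (After ` {1..n})" "j \<in> {1..n}"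
  shows "fst (search_step S t j) = After j"
proof -
  have link: "link S t' j = After j"
    if "t' \<in> insert Whole (After ` {1..n})" "j \<in> set_tree (tree_of S t')" for t'
    using mt that unfolding multiple_trees_def by blast
  have "bst (tree_of S t)" using assms(1) whole_tree after_tree by auto
  then show ?thesis
    using link[of t] link[of Whole] assms whole_tree(2) by (simp add: search_step_def found_iff)
qed

lemma run_time_eq:
  assumes "i \<in> {1..n}" "set xs \<subseteq> {1..n}"
  shows "run_time S (After i) xs =
    (\<Sum>k<length xs. snd (search_step S (After ((i # xs) ! k)) (xs ! k)))"
  using assms
proof (induction xs arbitrary: i)
  case (Cons x xs)
  then show ?case by (simp add: finger_after_search sum.lessThan_Suc_shift del: sum.lessThan_Suc)
qed simp

lemma visits_whole_le:
  assumes "n \<ge> 1"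
  shows "real (visits (tree_of S Whole) j) \<le> 1 + log 2 n"
proof -
  have "tree_of S Whole \<noteq> \<langle>\<rangle>" using size_whole_tree assms by auto
  then show ?thesis
    using acomplete_height_le[OF whole_tree(3)] visits_le_height[of "tree_of S Whole" j]
    by (simp add: size_whole_tree)
qed

lemma first_search_time:
  assumes "j \<in> {1..n}"
  shows "real (snd (search_step S Whole j)) \<le> 2 + log 2 n"
  using assms whole_tree visits_whole_le[of j] by (simp add: search_step_def found_iff)

text \<open>The summand 2 pays for the node of \<open>b\<close> and the final pointer on a hit,
  where \<open>L\<close> can be 0. The constant \<open>c\<close> may be negative, hence
  \<open>max c 0\<close>; base 1 would make the logarithm 0, hence \<open>max 2 d\<close>.\<close>

lemma search_time_le:
  assumes "1 \<le> d" "d \<le> n" and le: "sum (f2 a) {1..n} \<le> f a"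
    and a: "a \<in> {1..n}" and b: "b \<in> {1..n}" and pos: "f2 a b > 0"
  defines "L \<equiv> log 2 (real (f a) / real (f2 a b))"
  shows "real (snd (search_step S (After a) b))
    \<le> 2 + (max c 0 + 3) * (L * log (real (max 2 d)) n)"
proof -
  let ?T = "tree_of S (After a)"
  note T = after_tree[OF a]
  have "f2 a b \<le> f a" using le member_le_sum[of b "{1..n}" "f2 a"] b by simp
  then have L0: "L \<ge> 0" using pos by (simp add: L_def)
  have log1: "1 \<le> log (real (max 2 d)) n" if "n \<ge> 2"
    using that assms(1,2) by (subst one_le_log_cancel_iff) auto
  show ?thesis
  proof (cases "found ?T b")
    case True
    then have eq: "snd (search_step S (After a) b) = 2 + depth ?T b"
      by (simp add: search_step_def visits_eq_depth)
    show ?thesis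
    proof (cases "n \<ge> 2")
      case False
      \<comment> \<open>Here the logarithm of \<open>n\<close> is 0, so the depth must vanish
        exactly: the tree has a single node.\<close>
      then have "n = 1" "d = 1" using assms(1,2) by auto
      then show ?thesis using depth_less_size[OF True] size_after_tree[OF a] eq by simp
    next
      case n: True
      have "real (depth ?T b) \<le> c * L"
        using T(3)[of b] True pos found_iff[OF T(1)] by (simp add: L_def)
      also have "\<dots> \<le> (max c 0 + 3) * L" using L0 by (intro mult_right_mono) auto
      also have "\<dots> \<le> (max c 0 + 3) * (L * log (real (max 2 d)) n)"
        using L0 log1[OF n] mult_left_mono[of 1 "log (real (max 2 d)) n" L] by (intro mult_left_mono) auto
      finally show ?thesis using eq by simp
    qed
  next
    case False
    let ?K = "set_tree ?T"
    have bK: "b \<notin> ?K" using False found_iff[OF T(1)] by simp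
    have K: "?K \<subseteq> {1..n}" "card ?K = d" and ge: "\<And>k. k \<in> ?K \<Longrightarrow> f2 a b \<le> f2 a k"
      using T(2) b bK by (auto simp: top_keys_def)
    have "card (insert b ?K) = d + 1" using K bK by simp
    \<comment> \<open>A miss needs a key outside the tree, which excludes
      \<open>n = 1\<close>.\<close>
    then have "d + 1 \<le> n" using card_mono[of "{1..n}" "insert b ?K"] K b by simp
    then have n: "n \<ge> 2" using assms(1) by simp
    have "(d + 1) * f2 a b \<le> sum (f2 a) (insert b ?K)"
      using sum_bounded_below[of "insert b ?K" "f2 a b" "f2 a"] ge \<open>card (insert b ?K) = d + 1\<close>
      by auto
    also have "\<dots> \<le> sum (f2 a) {1..n}" using K b by (intro sum_mono2) auto
    finally have "(d + 1) * f2 a b \<le> f a" using le by simp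
    then have "real ((d + 1) * f2 a b) \<le> real (f a)" by (simp only: of_nat_le_iff)
    then have "real (d + 1) \<le> real (f a) / real (f2 a b)" using pos by (simp add: field_simps)
    then have Ld: "log 2 (d + 1) \<le> L" unfolding L_def by (intro log_mono) auto
    have "1 \<le> log 2 (d + 1)" using assms(1) by (subst one_le_log_cancel_iff) auto
    then have L1: "1 \<le> L" using Ld by (rule order_trans)
    \<comment> \<open>\<open>max 2 d\<close> is at most \<open>d + 1\<close> even for
      \<open>d = 1\<close>, so replacing the base keeps the bound by \<open>L\<close>.\<close>
    have "log 2 (real (max 2 d)) \<le> log 2 (d + 1)" using assms(1) by (intro log_mono) auto
    then have "log 2 (real (max 2 d)) \<le> L" using Ld by (rule order_trans)
    moreover have "log 2 n = log 2 (real (max 2 d)) * log (real (max 2 d)) n"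
      using n by (simp add: log_def)
    ultimately have lgn: "log 2 n \<le> L * log (real (max 2 d)) n"
      using log1[OF n] by (simp add: mult_right_mono)
    \<comment> \<open>The failed search in \<open>?T\<close> is charged to a key \<open>k\<close> of
      \<open>?T\<close>. As a top key, \<open>k\<close> is at least as frequent as \<open>b\<close>:
      its depth requirement is not void, and its logarithm is at most \<open>L\<close>.\<close>
    have "?T \<noteq> \<langle>\<rangle>" using size_after_tree[OF a] assms(1) by auto
    then obtain k where k: "k \<in> ?K" "visits ?T b \<le> Suc (depth ?T k)"
      using visits_le_depth[OF T(1)] by blast
    have fk: "0 < f2 a k" "f2 a k \<le> f a"
      using ge[OF k(1)] pos le member_le_sum[of k "{1..n}" "f2 a"] K(1) k(1) by auto
    have "real (depth ?T k) \<le> c * log 2 (f a / f2 a k)" using T(3)[OF k(1)] fk by simp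
    also have "\<dots> \<le> max c 0 * log 2 (f a / f2 a k)" using fk by (intro mult_right_mono) auto
    also have "\<dots> \<le> max c 0 * L"
      unfolding L_def using fk pos ge[OF k(1)]
      by (intro mult_left_mono log_mono divide_left_mono) auto
    finally have "real (visits ?T b) \<le> 1 + max c 0 * L" using k(2) by simp
    moreover have "snd (search_step S (After a) b)
      = visits ?T b + visits (tree_of S Whole) b + 2" using False by (simp add: search_step_def)
    ultimately have "real (snd (search_step S (After a) b)) \<le> 4 + max c 0 * L + log 2 n"
      using visits_whole_le[of b] n by simp
    \<comment> \<open>The surplus of 2 over a hit is at most \<open>2 * L\<close>, because a miss
      gives \<open>1 <= L\<close>.\<close>
    also have "\<dots> \<le> 2 + (max c 0 + 2) * L + L * log (real (max 2 d)) n"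
      using L1 lgn by (simp add: algebra_simps)
    also have "(max c 0 + 2) * L \<le> (max c 0 + 2) * (L * log (real (max 2 d)) n)"
      using L0 log1[OF n] mult_left_mono[of 1 "log (real (max 2 d)) n" L] by (intro mult_left_mono) auto
    finally show ?thesis by (simp add: algebra_simps)
  qed
qed

end

text \<open>The first search runs in \<open>Whole\<close> and costs at most
  \<open>2 + log 2 n\<close>; each later one adds 2 and its own share of the entropy sum.\<close>

lemma exec_time_le:
  assumes mt: "multiple_trees c n d (freq X) (pair_freq X) S"
    and "1 \<le> d" "d \<le> n" "X \<noteq> []" "set X \<subseteq> {1..n}"
  shows "real (exec_time S X) \<le>
    (max c 0 + 3) * (length X * cond_entropy n X * log (real (max 2 d)) n) + 2 * real (length X) + log 2 n"
proof -
  obtain x xs where X: "X = x # xs" using assms(4) by (cases X) auto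
  let ?C = "max c 0 + 3" and ?R = "log (real (max 2 d)) n"
  let ?L = "\<lambda>k. log 2 (freq X (X ! k) / pair_freq X (X ! k) (X ! Suc k))"
  have x: "x \<in> {1..n}" and xs: "set xs \<subseteq> {1..n}" using assms(5) X by auto
  have step: "real (snd (search_step S (After (X ! k)) (xs ! k))) \<le> 2 + ?C * (?L k * ?R)"
    if k: "k < length xs" for k
  proof -
    have "finite {q. Suc q < length X \<and> X ! q = X ! k \<and> X ! Suc q = X ! Suc k}"
      by (rule finite_subset[of _ "{..<length X}"]) auto
    then have "pair_freq X (X ! k) (X ! Suc k) > 0"
      unfolding pair_freq_def using k X by (subst card_gt_0_iff) auto
    moreover have "k < length X" "Suc k < length X" using k X by auto
    then have "X ! k \<in> {1..n}" "X ! Suc k \<in> {1..n}"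
      using assms(5) nth_mem by blast+
    ultimately show ?thesis
      using search_time_le[OF mt assms(2,3) sum_pair_freq_le_freq, of "X ! k" "X ! Suc k"] X by simp
  qed
  have "real (exec_time S X) = real (snd (search_step S Whole x))
    + (\<Sum>k<length xs. real (snd (search_step S (After (X ! k)) (xs ! k))))"
    using finger_after_search[OF mt _ x, of Whole] run_time_eq[OF mt x xs]
    by (simp add: exec_time_def X)
  also have "\<dots> \<le> (2 + log 2 n) + (\<Sum>k<length xs. 2 + ?C * (?L k * ?R))"
    using step by (intro add_mono first_search_time[OF mt x] sum_mono) auto
  also have "(\<Sum>k<length xs. 2 + ?C * (?L k * ?R))
    = 2 * length xs + ?C * ((\<Sum>k<length xs. ?L k) * ?R)"
    by (simp add: sum.distrib sum_distrib_left sum_distrib_right)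
  also have "(\<Sum>k<length xs. ?L k) = length X * cond_entropy n X"
    using length_times_cond_entropy[OF assms(5,4)] X by simp
  finally show ?thesis using X by simp
qed

lemma cond_entropy_nonneg: "0 \<le> cond_entropy n X"
  unfolding cond_entropy_def
proof (intro sum_nonneg)
  fix a b
  have "pair_freq X a b \<le> freq X a" using sum_pair_freq_le_freq[of "{b}" X a] by simp
  then show "0 \<le> (if pair_freq X a b = 0 then 0 else real (pair_freq X a b) / real (length X)
               * log 2 (real (freq X a) / real (pair_freq X a b)))"
    by (auto intro!: mult_nonneg_nonneg)
qed

theorem theorem5:
  shows "(\<exists>c>0. \<forall>(n::nat) (d::nat) (X::nat list).
            1 \<le> d \<longrightarrow> d \<le> n \<longrightarrow> X \<noteq> [] \<longrightarrow> set X \<subseteq> {1..n} \<longrightarrow>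
            (\<exists>S. multiple_trees c n d (freq X) (pair_freq X) S)) \<and>
         (\<forall>c::real. \<exists>C::real. \<forall>(n::nat) (d::nat) (X::nat list) (S::forest).
            1 \<le> d \<longrightarrow> d \<le> n \<longrightarrow> X \<noteq> [] \<longrightarrow> set X \<subseteq> {1..n} \<longrightarrow>
            multiple_trees c n d (freq X) (pair_freq X) S \<longrightarrow>
            real (exec_time S X)
              \<le> C * (real (length X) * cond_entropy n X * log (real (max 2 d)) (real n))
                + 2 * real (length X) + log 2 (real n) \<and>
            real (space n S) \<le> C * (real n * real d))"
proof (intro conjI allI)
  show "\<exists>c>0. \<forall>(n::nat) (d::nat) (X::nat list).
            1 \<le> d \<longrightarrow> d \<le> n \<longrightarrow> X \<noteq> [] \<longrightarrow> set X \<subseteq> {1..n} \<longrightarrow>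
            (\<exists>S. multiple_trees c n d (freq X) (pair_freq X) S)"
    using multiple_trees_exists[OF _ sum_pair_freq_le_freq] by (intro exI[of _ 1]) simp
next
  fix c :: real
  let ?C = "max c 0 + 10"
  show "\<exists>C::real. \<forall>(n::nat) (d::nat) (X::nat list) (S::forest).
            1 \<le> d \<longrightarrow> d \<le> n \<longrightarrow> X \<noteq> [] \<longrightarrow> set X \<subseteq> {1..n} \<longrightarrow>
            multiple_trees c n d (freq X) (pair_freq X) S \<longrightarrow>
            real (exec_time S X)
              \<le> C * (real (length X) * cond_entropy n X * log (real (max 2 d)) (real n))
                + 2 * real (length X) + log 2 (real n) \<and>
            real (space n S) \<le> C * (real n * real d)"
  proof (intro exI[of _ ?C] allI impI conjI)
    fix n d X S
    assume A: "1 \<le> d" "d \<le> n" "X \<noteq> []" "set X \<subseteq> {1..n}"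
      and mt: "multiple_trees c n d (freq X) (pair_freq X) S"
    have "0 \<le> length X * cond_entropy n X * log (real (max 2 d)) n"
      using cond_entropy_nonneg[of n X] A(1,2) by (auto intro!: mult_nonneg_nonneg)
    then have "(max c 0 + 3) * (length X * cond_entropy n X * log (real (max 2 d)) n)
      \<le> ?C * (length X * cond_entropy n X * log (real (max 2 d)) n)"
      by (intro mult_right_mono) auto
    then show "real (exec_time S X)
        \<le> ?C * (real (length X) * cond_entropy n X * log (real (max 2 d)) (real n))
          + 2 * real (length X) + log 2 (real n)"
      using exec_time_le[OF mt A] by linarith
    have "n \<le> n * d" using A(1) by simp
    moreover have "1 \<le> n" using A(1,2) by simp
    ultimately have "4 * (n + n * d) + 2 \<le> 10 * (n * d)"
      unfolding distrib_left by linarith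
    then have "space n S \<le> 10 * (n * d)" by (simp only: space_eq[OF mt])
    then have "real (space n S) \<le> 10 * (real n * real d)"
      by (simp flip: of_nat_mult)
    also have "\<dots> \<le> ?C * (real n * real d)" by (intro mult_right_mono) auto
    finally show "real (space n S) \<le> ?C * (real n * real d)" .
  qed
qed

end
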